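(* Let $\Omega\subset\mathbb{R}^3$ be a bounded Lipschitz domain and let $A\in\mathscr{D}'(\Omega,\mathfrak{so}(3))$. Then (a) the entries of $\mathrm{D}^2A$ are linear combinations of the entries of $\mathrm{D}\,\operatorname{sym}\operatorname{Curl}A$; (b) the entries of $\mathrm{D}^3A$ are linear combinations of the entries of $\mathrm{D}^2\operatorname{dev}\operatorname{sym}\operatorname{Curl}A$.
   Context: $\mathscr{D}'(\Omega,\mathfrak{so}(3))$ denotes distributions on $\Omega$ with values in the space $\mathfrak{so}(3)$ of skew-symmetric $3\times3$ matrices. For $X\in\mathbb{R}^{3\times3}$: $\operatorname{sym}X=\frac12(X+X^T)$, $\operatorname{dev}X=X-\frac13\operatorname{tr}(X)\,\mathrm{Id}$. $\operatorname{Curl}$ is the usual curl applied row-wise to matrix fields, in the distributional sense. $\mathrm{D}^kB$ denotes the collection of all distributional partial derivatives of order $k$ of the components of $B$. Linear combinations are with constant real coefficients that do not depend on $A$ (i.e. given by a constant-coefficient linear operator). *)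

theory Defs
  imports "HOL-Analysis.Analysis"
begin

subsection \<open>Lipschitz domains\<close>

text \<open>Near each boundary point the set is, after an orthogonal change of coordinates, the strict
  epigraph of a Lipschitz function.  No translation is needed since \<open>g\<close> is arbitrary.\<close>

definition lipschitz_boundary :: "(real^3) set \<Rightarrow> bool" where
  "lipschitz_boundary \<Omega> \<longleftrightarrow>
    (\<forall>p\<in>frontier \<Omega>. \<exists>r>0. \<exists>Q :: real^3 \<Rightarrow> real^3. \<exists>g :: real^2 \<Rightarrow> real. \<exists>L.
      orthogonal_transformation Q \<and> L-lipschitz_on UNIV g \<and>
      \<Omega> \<inter> ball p r = {x \<in> ball p r. Q x $ 3 > g (vector [Q x $ 1, Q x $ 2])})"

definition bounded_lipschitz_domain :: "(real^3) set \<Rightarrow> bool" where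
  "bounded_lipschitz_domain \<Omega> \<longleftrightarrow>
    open \<Omega> \<and> connected \<Omega> \<and> \<Omega> \<noteq> {} \<and> bounded \<Omega> \<and> lipschitz_boundary \<Omega>"

subsection \<open>Test functions\<close>

definition partial :: "'n \<Rightarrow> (real^'n::finite \<Rightarrow> real) \<Rightarrow> real^'n \<Rightarrow> real" where
  "partial k f x = frechet_derivative f (at x) (axis k 1)"

text \<open>All iterated partial derivatives are differentiable everywhere, hence also continuous.\<close>

definition smooth :: "(real^'n::finite \<Rightarrow> real) \<Rightarrow> bool" where
  "smooth f \<longleftrightarrow> (\<forall>ks x. foldr partial ks f differentiable at x)"

definition supp :: "(real^'n::finite \<Rightarrow> real) \<Rightarrow> (real^'n) set" where
  "supp f = closure {x. f x \<noteq> 0}"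

text \<open>Elements of \<open>C\<^sub>c\<^sup>\<infinity>(\<Omega>)\<close> are represented by their extensions by zero to the whole space.\<close>

definition test_functions :: "(real^'n::finite) set \<Rightarrow> (real^'n \<Rightarrow> real) set" where
  "test_functions \<Omega> = {f. smooth f \<and> compact (supp f) \<and> supp f \<subseteq> \<Omega>}"

text \<open>Convergence to zero in the space of test functions: supports in a common compact subset
  of \<open>\<Omega>\<close> and uniform convergence of every partial derivative.\<close>

definition test_null_sequence :: "(real^'n::finite) set \<Rightarrow> (nat \<Rightarrow> real^'n \<Rightarrow> real) \<Rightarrow> bool" where
  "test_null_sequence \<Omega> f \<longleftrightarrow>
    (\<forall>n. f n \<in> test_functions \<Omega>) \<and>
    (\<exists>K. compact K \<and> K \<subseteq> \<Omega> \<and> (\<forall>n. supp (f n) \<subseteq> K)) \<and>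
    (\<forall>ks. uniform_limit UNIV (\<lambda>n. foldr partial ks (f n)) (\<lambda>x. 0) sequentially)"

subsection \<open>Vector-valued distributions\<close>

text \<open>A distribution on \<open>\<Omega>\<close> is a (sequentially) continuous linear map on the test functions.
  Functions being total in HOL, its values off \<open>test_functions \<Omega>\<close> are irrelevant; equality
  of distributions on \<open>\<Omega>\<close> means equality at every element of \<open>test_functions \<Omega>\<close>.\<close>

type_synonym ('n, 'b) distr = "(real^'n \<Rightarrow> real) \<Rightarrow> 'b"

definition distribution :: "(real^'n::finite) set \<Rightarrow> ('n, 'b::real_normed_vector) distr \<Rightarrow> bool" where
  "distribution \<Omega> T \<longleftrightarrow>
    (\<forall>f\<in>test_functions \<Omega>. \<forall>g\<in>test_functions \<Omega>. T (\<lambda>x. f x + g x) = T f + T g) \<and>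
    (\<forall>c. \<forall>f\<in>test_functions \<Omega>. T (\<lambda>x. c * f x) = c *\<^sub>R T f) \<and>
    (\<forall>f. test_null_sequence \<Omega> f \<longrightarrow> (\<lambda>n. T (f n)) \<longlonglongrightarrow> 0)"

definition distributions_on :: "(real^'n::finite) set \<Rightarrow> 'b::real_normed_vector set \<Rightarrow> ('n, 'b) distr set" where
  "distributions_on \<Omega> V = {T. distribution \<Omega> T \<and> (\<forall>f\<in>test_functions \<Omega>. T f \<in> V)}"

definition dpartial :: "'n \<Rightarrow> ('n::finite, 'b::real_normed_vector) distr \<Rightarrow> ('n, 'b) distr" where
  "dpartial k T = (\<lambda>f. - T (partial k f))"

definition curl :: "(3, real^3) distr \<Rightarrow> (3, real^3) distr" where
  "curl v = (\<lambda>f. vector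
    [dpartial 2 v f $ 3 - dpartial 3 v f $ 2,
     dpartial 3 v f $ 1 - dpartial 1 v f $ 3,
     dpartial 1 v f $ 2 - dpartial 2 v f $ 1])"

definition Curl :: "(3, real^3^3) distr \<Rightarrow> (3, real^3^3) distr" where
  "Curl B = (\<lambda>f. \<chi> i. curl (\<lambda>h. B h $ i) f)"

subsection \<open>Matrices\<close>

definition so3 :: "(real^3^3) set" where
  "so3 = {X. transpose X = - X}"

definition sym_part :: "real^3^3 \<Rightarrow> real^3^3" where
  "sym_part X = (1/2) *\<^sub>R (X + transpose X)"

definition dev_part :: "real^3^3 \<Rightarrow> real^3^3" where
  "dev_part X = X - (1/3 * trace X) *\<^sub>R mat 1"

text \<open>Since \<open>sym\<close> and \<open>dev\<close> are linear with constant coefficients, they act on a matrix-valued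
  distribution by composition with its values.\<close>

definition sym_Curl :: "(3, real^3^3) distr \<Rightarrow> (3, real^3^3) distr" where
  "sym_Curl B = sym_part \<circ> Curl B"

definition dev_sym_Curl :: "(3, real^3^3) distr \<Rightarrow> (3, real^3^3) distr" where
  "dev_sym_Curl B = dev_part \<circ> sym_Curl B"

end

(* A skew-symmetric field is A = Anti a for its axial vector field a, and then
   Curl A = (div a) Id - (Da)^T.  Hence sym Curl A determines the symmetrized gradient
   e = sym Da, and dev sym Curl A = - dev e.
   (a) d_k d_l a_i = d_k e_li + d_l e_ik - d_i e_kl.
   (b) It remains to recover D^2 (tr e) from D^2 (dev e).  Contracting the Saint-Venant
   compatibility conditions for e, which hold because e is a symmetrized gradient, gives
   D^2 (tr e) + Laplace (tr e) Id in terms of D^2 (dev e); its trace is 4 Laplace (tr e).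
   Besides the pointwise algebra this uses only that partial derivatives of a test function
   are test functions and commute. *)

theory Submission
  imports Defs
begin

section \<open>Partial derivatives of smooth functions\<close>

lemma smooth_differentiable:
  assumes "smooth f"
  shows "f differentiable at x"
  using assms unfolding smooth_def by (metis foldr_Nil id_apply)

lemma smooth_partial:
  assumes "smooth f"
  shows "smooth (partial k f)"
  unfolding smooth_def
proof (intro allI)
  fix ks x
  have "foldr partial ks (partial k f) = foldr partial (ks @ [k]) f"
    by simp
  then show "foldr partial ks (partial k f) differentiable at x"
    using assms unfolding smooth_def by metis
qed

lemma smooth_isCont:
  assumes "smooth f"
  shows "isCont f x"
  using assms smooth_differentiable differentiable_imp_continuous_within by blast

section \<open>Symmetry of second partial derivatives\<close>

lemma has_derivative_along_axis:
  assumes "smooth f"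
  shows "((\<lambda>s. f (y + s *\<^sub>R axis k 1)) has_real_derivative
           partial k f (y + s *\<^sub>R axis k 1)) (at s)"
proof -
  let ?L = "frechet_derivative f (at (y + s *\<^sub>R axis k 1))"
  have L: "(f has_derivative ?L) (at (y + s *\<^sub>R axis k 1))"
    using assms smooth_differentiable frechet_derivative_works by blast
  have "((\<lambda>s. y + s *\<^sub>R axis k 1) has_derivative (\<lambda>t. t *\<^sub>R axis k 1)) (at s)"
    by (auto intro!: derivative_eq_intros)
  from diff_chain_at[OF this L]
  have "((\<lambda>s. f (y + s *\<^sub>R axis k 1)) has_derivative (\<lambda>t. ?L (t *\<^sub>R axis k 1))) (at s)"
    by (simp add: o_def)
  moreover have "?L (t *\<^sub>R axis k 1) = t * partial k f (y + s *\<^sub>R axis k 1)" for t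
    using linear_scale[OF has_derivative_linear[OF L]] by (simp add: partial_def)
  ultimately show ?thesis
    by (simp add: has_field_derivative_def mult_commute_abs)
qed

text \<open>The mean value theorem is applied twice: along \<open>axis k 1\<close> to a difference
  of two translates of \<open>f\<close>, then along \<open>axis l 1\<close> to
  \<open>partial k f\<close>.\<close>

lemma second_difference_mean_value:
  assumes f: "smooth f" and h: "0 < h"
  obtains \<xi> \<eta> where "0 < \<xi>" "\<xi> < h" "0 < \<eta>" "\<eta> < h"
    "f (x + h *\<^sub>R axis k 1 + h *\<^sub>R axis l 1) - f (x + h *\<^sub>R axis k 1)
       - f (x + h *\<^sub>R axis l 1) + f x
     = h\<^sup>2 * partial l (partial k f) (x + \<xi> *\<^sub>R axis k 1 + \<eta> *\<^sub>R axis l 1)"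
proof -
  let ?u = "axis k 1 :: real^'a" and ?v = "axis l 1 :: real^'a"
  let ?g = "\<lambda>s. f (x + h *\<^sub>R ?v + s *\<^sub>R ?u) - f (x + s *\<^sub>R ?u)"
  have "\<exists>\<xi>>0. \<xi> < h \<and> ?g h - ?g 0 = (h - 0) *
      (partial k f (x + h *\<^sub>R ?v + \<xi> *\<^sub>R ?u) - partial k f (x + \<xi> *\<^sub>R ?u))"
    using h by (intro MVT2 DERIV_diff has_derivative_along_axis f)
  then obtain \<xi> where \<xi>: "0 < \<xi>" "\<xi> < h" "?g h - ?g 0 = h *
      (partial k f (x + h *\<^sub>R ?v + \<xi> *\<^sub>R ?u) - partial k f (x + \<xi> *\<^sub>R ?u))"
    by auto
  let ?p = "\<lambda>t. partial k f (x + \<xi> *\<^sub>R ?u + t *\<^sub>R ?v)"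
  have "\<exists>\<eta>>0. \<eta> < h \<and> ?p h - ?p 0 = (h - 0) *
      partial l (partial k f) (x + \<xi> *\<^sub>R ?u + \<eta> *\<^sub>R ?v)"
    using h by (intro MVT2 has_derivative_along_axis smooth_partial f)
  then obtain \<eta> where \<eta>: "0 < \<eta>" "\<eta> < h" "?p h - ?p 0 = h *
      partial l (partial k f) (x + \<xi> *\<^sub>R ?u + \<eta> *\<^sub>R ?v)"
    by auto
  have "?g h - ?g 0 = h * (?p h - ?p 0)"
    using \<xi>(3) by (simp add: add_ac)
  then have "?g h - ?g 0 = h\<^sup>2 * partial l (partial k f) (x + \<xi> *\<^sub>R ?u + \<eta> *\<^sub>R ?v)"
    using \<eta>(3) by (simp add: power2_eq_square)
  moreover have "?g h - ?g 0 = f (x + h *\<^sub>R ?u + h *\<^sub>R ?v) - f (x + h *\<^sub>R ?u)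
      - f (x + h *\<^sub>R ?v) + f x"
    by (simp add: add_ac)
  ultimately show thesis
    using that[OF \<xi>(1,2) \<eta>(1,2)] by simp
qed

lemma partial_commute:
  assumes f: "smooth f"
  shows "partial k (partial l f) = partial l (partial k f)"
proof
  fix x
  let ?u = "axis k 1 :: real^'a" and ?v = "axis l 1 :: real^'a"
  define h where "h = (\<lambda>n. inverse (real (Suc n)))"
  have h: "0 < h n" for n
    by (simp add: h_def)
  have h0: "h \<longlonglongrightarrow> 0"
    unfolding h_def by (rule LIMSEQ_inverse_real_of_nat)
  \<comment> \<open>This quotient is symmetric in the two directions, so both mixed derivatives
    arise as its limit.\<close>
  let ?D = "\<lambda>n. (f (x + h n *\<^sub>R ?u + h n *\<^sub>R ?v) - f (x + h n *\<^sub>R ?u)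
       - f (x + h n *\<^sub>R ?v) + f x) / (h n)\<^sup>2"
  \<comment> \<open>The intermediate points are squeezed towards \<open>x\<close>, so continuity of
    \<open>G\<close> gives the limit.\<close>
  have lim: "D \<longlonglongrightarrow> G x"
    if G: "smooth G"
      and mv: "\<And>n. \<exists>\<xi> \<eta>. 0 < \<xi> \<and> \<xi> < h n \<and> 0 < \<eta> \<and> \<eta> < h n \<and> D n = G (x + \<xi> *\<^sub>R ?u + \<eta> *\<^sub>R ?v)"
    for D :: "nat \<Rightarrow> real" and G
  proof -
    obtain \<xi> \<eta> where
      *: "\<And>n. 0 < \<xi> n" "\<And>n. \<xi> n < h n" "\<And>n. 0 < \<eta> n" "\<And>n. \<eta> n < h n"
        "\<And>n. D n = G (x + \<xi> n *\<^sub>R ?u + \<eta> n *\<^sub>R ?v)"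
      using mv by metis
    have "\<xi> \<longlonglongrightarrow> 0" "\<eta> \<longlonglongrightarrow> 0"
      using * by (auto intro!: tendsto_sandwich[OF _ _ tendsto_const h0] always_eventually less_imp_le)
    then have "(\<lambda>n. x + \<xi> n *\<^sub>R ?u + \<eta> n *\<^sub>R ?v) \<longlonglongrightarrow> x + 0 *\<^sub>R ?u + 0 *\<^sub>R ?v"
      by (intro tendsto_intros)
    then have "(\<lambda>n. G (x + \<xi> n *\<^sub>R ?u + \<eta> n *\<^sub>R ?v)) \<longlonglongrightarrow> G x"
      using isCont_tendsto_compose[OF smooth_isCont[OF G]] by force
    then show ?thesis
      by (simp only: *(5)[symmetric])
  qed
  have "?D \<longlonglongrightarrow> partial l (partial k f) x"
  proof (rule lim)
    fix n
    obtain \<xi> \<eta> where "0 < \<xi>" "\<xi> < h n" "0 < \<eta>" "\<eta> < h n"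
      "f (x + h n *\<^sub>R ?u + h n *\<^sub>R ?v) - f (x + h n *\<^sub>R ?u) - f (x + h n *\<^sub>R ?v) + f x
        = (h n)\<^sup>2 * partial l (partial k f) (x + \<xi> *\<^sub>R ?u + \<eta> *\<^sub>R ?v)"
      using second_difference_mean_value[OF f h] by blast
    then show "\<exists>\<xi> \<eta>. 0 < \<xi> \<and> \<xi> < h n \<and> 0 < \<eta> \<and> \<eta> < h n \<and>
        ?D n = partial l (partial k f) (x + \<xi> *\<^sub>R ?u + \<eta> *\<^sub>R ?v)"
      using h[of n] by force
  qed (intro smooth_partial f)
  moreover have "?D \<longlonglongrightarrow> partial k (partial l f) x"
  proof (rule lim)
    fix n
    \<comment> \<open>The same quotient, with the directions exchanged in the mean value
      lemma.\<close>
    obtain \<eta> \<xi> where "0 < \<eta>" "\<eta> < h n" "0 < \<xi>" "\<xi> < h n"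
      "f (x + h n *\<^sub>R ?v + h n *\<^sub>R ?u) - f (x + h n *\<^sub>R ?v) - f (x + h n *\<^sub>R ?u) + f x
        = (h n)\<^sup>2 * partial k (partial l f) (x + \<eta> *\<^sub>R ?v + \<xi> *\<^sub>R ?u)"
      using second_difference_mean_value[OF f h] by blast
    then have "0 < \<xi> \<and> \<xi> < h n \<and> 0 < \<eta> \<and> \<eta> < h n \<and>
        ?D n = partial k (partial l f) (x + \<xi> *\<^sub>R ?u + \<eta> *\<^sub>R ?v)"
      using h[of n] by (simp add: add_ac field_simps)
    then show "\<exists>\<xi> \<eta>. 0 < \<xi> \<and> \<xi> < h n \<and> 0 < \<eta> \<and> \<eta> < h n \<and>
        ?D n = partial k (partial l f) (x + \<xi> *\<^sub>R ?u + \<eta> *\<^sub>R ?v)"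
      by blast
  qed (intro smooth_partial f)
  ultimately show "partial k (partial l f) x = partial l (partial k f) x"
    using LIMSEQ_unique by blast
qed

section \<open>Stability of test functions under partial derivatives\<close>

lemma supp_partial_subset: "supp (partial k f) \<subseteq> supp f"
proof -
  have "partial k f x = 0" if "x \<notin> supp f" for x
  proof -
    have "open (- supp f)"
      by (simp add: supp_def open_Compl)
    moreover have "f y = 0" if "y \<in> - supp f" for y
      using that closure_subset[of "{x. f x \<noteq> 0}"] by (auto simp: supp_def)
    ultimately have "(f has_derivative (\<lambda>_. 0)) (at x)"
      using \<open>x \<notin> supp f\<close>
      by (intro has_derivative_transform_within_open[of "\<lambda>_. 0" "\<lambda>_. 0" x UNIV "- supp f" f]) auto
    then show ?thesis
      by (simp add: partial_def frechet_derivative_at[symmetric])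
  qed
  then have "{x. partial k f x \<noteq> 0} \<subseteq> supp f"
    by blast
  then show ?thesis
    unfolding supp_def[of "partial k f"] by (intro closure_minimal) (simp_all add: supp_def)
qed

lemma partial_test_function:
  assumes "f \<in> test_functions \<Omega>"
  shows "partial k f \<in> test_functions \<Omega>"
proof -
  have "compact (supp (partial k f))"
    using assms supp_partial_subset[of k f] unfolding test_functions_def
    by (metis (no_types, lifting) closed_closure compact_Int_closed inf.absorb2 mem_Collect_eq supp_def)
  then show ?thesis
    using assms supp_partial_subset[of k f] smooth_partial unfolding test_functions_def by blast
qed

section \<open>Linear combinations of functionals\<close>

text \<open>The coefficients are fixed before \<open>x\<close>. With \<open>S\<close> a set of pairs
  of a distribution and a test function, they depend on neither.\<close>

definition lin_comb :: "'a set \<Rightarrow> ('i::finite \<Rightarrow> 'a \<Rightarrow> real) \<Rightarrow> ('a \<Rightarrow> real) \<Rightarrow> bool" where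
  "lin_comb S G F \<longleftrightarrow> (\<exists>c. \<forall>x\<in>S. F x = (\<Sum>i\<in>UNIV. c i * G i x))"

lemma lin_comb_generator: "lin_comb S G (G i)"
  unfolding lin_comb_def
  by (rule exI[of _ "\<lambda>j. if j = i then 1 else 0"]) (simp add: if_distrib[of "\<lambda>c. c * _"] cong: if_cong)

lemma lin_comb_add:
  assumes "lin_comb S G F" "lin_comb S G F'"
  shows "lin_comb S G (\<lambda>x. F x + F' x)"
proof -
  obtain c c' where "\<forall>x\<in>S. F x = (\<Sum>i\<in>UNIV. c i * G i x)" "\<forall>x\<in>S. F' x = (\<Sum>i\<in>UNIV. c' i * G i x)"
    using assms unfolding lin_comb_def by blast
  then show ?thesis
    unfolding lin_comb_def
    by (intro exI[of _ "\<lambda>i. c i + c' i"]) (simp add: distrib_right sum.distrib)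
qed

lemma lin_comb_cmult:
  assumes "lin_comb S G F"
  shows "lin_comb S G (\<lambda>x. a * F x)"
proof -
  obtain c where "\<forall>x\<in>S. F x = (\<Sum>i\<in>UNIV. c i * G i x)"
    using assms unfolding lin_comb_def by blast
  then show ?thesis
    unfolding lin_comb_def
    by (intro exI[of _ "\<lambda>i. a * c i"]) (simp add: sum_distrib_left mult.assoc)
qed

lemma lin_comb_zero: "lin_comb S G (\<lambda>x. 0)"
  unfolding lin_comb_def by (rule exI[of _ "\<lambda>_. 0"]) simp

lemma lin_comb_diff:
  assumes "lin_comb S G F" "lin_comb S G F'"
  shows "lin_comb S G (\<lambda>x. F x - F' x)"
  using lin_comb_add[OF assms(1) lin_comb_cmult[OF assms(2), of "-1"]] by simp

lemma lin_comb_sum: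
  assumes "\<And>j. j \<in> J \<Longrightarrow> lin_comb S G (F j)"
  shows "lin_comb S G (\<lambda>x. \<Sum>j\<in>J. F j x)"
  using assms by (induction J rule: infinite_finite_induct) (simp_all add: lin_comb_zero lin_comb_add)

lemma lin_comb_cong:
  assumes "lin_comb S G F" "\<And>x. x \<in> S \<Longrightarrow> F' x = F x"
  shows "lin_comb S G F'"
  using assms unfolding lin_comb_def by simp

lemmas lin_comb_intros =
  lin_comb_generator lin_comb_add lin_comb_diff lin_comb_cmult lin_comb_sum lin_comb_zero

section \<open>Symmetrized gradients\<close>

text \<open>In this section \<open>Y m p q\<close> stands for \<open>\<partial>\<^sub>m \<partial>\<^sub>p a\<^sub>q\<close> and \<open>Z n m p q\<close> for
  \<open>\<partial>\<^sub>n \<partial>\<^sub>m \<partial>\<^sub>p a\<^sub>q\<close>, while \<open>S\<close> stands for the corresponding derivatives of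
  \<open>sym Curl A\<close> and \<open>dev sym Curl A\<close>; \<open>\<theta>\<close> is the Hessian of \<open>div a\<close>.\<close>

definition kron :: "'n \<Rightarrow> 'n \<Rightarrow> real" where
  "kron p q = (if p = q then 1 else 0)"

text \<open>The trace of \<open>S\<close> over its last two indices is twice that of
  \<open>Y\<close>, whence the factor \<open>1/2\<close>; so \<open>e\<close> is the derivative of
  the symmetrized gradient. In the final combination the second derivatives of the components
  \<open>k\<close> and \<open>l\<close> cancel by symmetry.\<close>

lemma second_gradient_eq:
  fixes Y :: "3 \<Rightarrow> 3 \<Rightarrow> 3 \<Rightarrow> real"
  assumes sym: "\<And>m p q. Y m p q = Y p m q"
    and e: "\<And>m p q. S m p q = kron p q * (\<Sum>r\<in>UNIV. Y m r r) - (Y m p q + Y m q p) / 2"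
  defines "e \<equiv> \<lambda>m p q. kron p q * ((1/2) * (\<Sum>r\<in>UNIV. S m r r)) - S m p q"
  shows "Y k l i = e k l i + e l k i - e i k l"
proof -
  have "e m p q = (Y m p q + Y m q p) / 2" for m p q
    unfolding e_def e by (simp add: sum_3 kron_def)
  then show ?thesis
    using sym[of k l i] sym[of k i l] sym[of l i k] by (simp only:) argo
qed

text \<open>Here \<open>S\<close> is minus the second derivatives of the deviator of the symmetrized
  gradient. Contracted Saint-Venant compatibility makes \<open>3 * R k l\<close> the Hessian of div
  a plus \<open>kron k l\<close> times its Laplacian. The double divergence, the sum of
  \<open>S p q p q\<close>, is -2/3 of that Laplacian, so the term with \<open>3/2\<close> removes
  it. Once the trace is known, the combination is that of \<open>second_gradient_eq\<close> with one
  more derivative.\<close>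

lemma third_gradient_eq:
  fixes Z :: "3 \<Rightarrow> 3 \<Rightarrow> 3 \<Rightarrow> 3 \<Rightarrow> real"
  assumes sym: "\<And>n m p q. Z n m p q = Z m n p q" "\<And>n m p q. Z n m p q = Z n p m q"
    and S: "\<And>n m p q. S n m p q = kron p q * ((1/3) * (\<Sum>r\<in>UNIV. Z n m r r)) - (Z n m p q + Z n m q p) / 2"
  defines "R \<equiv> \<lambda>k l. \<Sum>r\<in>UNIV. S r r k l - S r l r k - S r k r l"
  defines "\<theta> \<equiv> \<lambda>k l. 3 * R k l + kron k l * ((3/2) * (\<Sum>p\<in>UNIV. \<Sum>q\<in>UNIV. S p q p q))"
  defines "e \<equiv> \<lambda>n m p q. kron p q * ((1/3) * \<theta> n m) - S n m p q"
  shows "Z n k l i = e n k l i + e n l k i - e n i k l"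
proof -
  have "\<theta> n m = (\<Sum>r\<in>UNIV. Z n m r r)" for n m
  proof -
    \<comment> \<open>After enumeration of the indices, \<open>sym\<close> serves as permutative
      rewriting that brings the three derivative indices into a normal order.\<close>
    have "n \<in> {1, 2, 3}" "m \<in> {1, 2, 3}"
      using exhaust_3[of n] exhaust_3[of m] by auto
    then show ?thesis
      by (auto simp: \<theta>_def R_def S sum_3 kron_def sym field_simps)
  qed
  then have "e n m p q = (Z n m p q + Z n m q p) / 2" for n m p q
    unfolding e_def S by simp
  then show ?thesis
    using sym(2)[of n k l i] sym(2)[of n k i l] sym(2)[of n l i k] by (simp only:) argo
qed

section \<open>Skew-symmetric fields\<close>

text \<open>For skew-symmetric \<open>X\<close> this is the vector a such that \<open>X\<close> acts
  as the cross product with a from the left.\<close>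

definition axial :: "real^3^3 \<Rightarrow> real^3" where
  "axial X = vector [X $ 3 $ 2, X $ 1 $ 3, X $ 2 $ 1]"

lemma so3_entries:
  assumes "X \<in> so3"
  shows "X $ i $ j = - X $ j $ i"
proof -
  have "transpose X $ j $ i = (- X) $ j $ i"
    using assms by (simp add: so3_def)
  then show ?thesis
    by (simp add: transpose_def)
qed

lemma so3_axial_entries:
  assumes "X \<in> so3"
  shows "X $ 1 $ 1 = 0" "X $ 2 $ 2 = 0" "X $ 3 $ 3 = 0"
    "X $ 3 $ 2 = axial X $ 1" "X $ 1 $ 3 = axial X $ 2" "X $ 2 $ 1 = axial X $ 3"
    "X $ 2 $ 3 = - axial X $ 1" "X $ 3 $ 1 = - axial X $ 2" "X $ 1 $ 2 = - axial X $ 3"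
  using so3_entries[OF assms, of 1 1] so3_entries[OF assms, of 2 2] so3_entries[OF assms, of 3 3]
    so3_entries[OF assms, of 2 3] so3_entries[OF assms, of 3 1] so3_entries[OF assms, of 1 2]
  by (simp_all add: axial_def)

text \<open>\<open>X m i\<close> is the distributional derivative of the axial component
  \<open>i\<close> in direction \<open>m\<close>, tested against \<open>h\<close>; its sign is that
  of \<open>dpartial\<close>. The formula is the symmetric part of (div a) Id - (Da)^T.\<close>

lemma sym_Curl_axial:
  assumes "\<And>k. A (partial k h) \<in> so3"
  defines "X \<equiv> \<lambda>m i. - axial (A (partial m h)) $ i"
  shows "sym_Curl A h $ p $ q = kron p q * (\<Sum>r\<in>UNIV. X r r) - (X p q + X q p) / 2"
proof -
  have pq: "p \<in> {1, 2, 3}" "q \<in> {1, 2, 3}"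
    using exhaust_3[of p] exhaust_3[of q] by auto
  show ?thesis
    using pq
    by (auto simp: sym_Curl_def sym_part_def Curl_def curl_def dpartial_def transpose_def
        X_def kron_def sum_3 so3_axial_entries[OF assms(1)] field_simps)
qed

text \<open>The trace of \<open>sym_Curl\<close> is twice the divergence; removing a third of it
  lowers the coefficient from 1 to \<open>1/3\<close>.\<close>

lemma dev_sym_Curl_axial:
  assumes "\<And>k. A (partial k h) \<in> so3"
  defines "X \<equiv> \<lambda>m i. - axial (A (partial m h)) $ i"
  shows "dev_sym_Curl A h $ p $ q =
    kron p q * ((1/3) * (\<Sum>r\<in>UNIV. X r r)) - (X p q + X q p) / 2"
proof -
  have S: "sym_Curl A h $ p $ q = kron p q * (\<Sum>r\<in>UNIV. X r r) - (X p q + X q p) / 2" for p q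
    unfolding X_def by (intro sym_Curl_axial assms(1))
  show ?thesis
    by (simp add: dev_sym_Curl_def dev_part_def trace_def mat_def S kron_def sum_3 field_simps)
qed

text \<open>Each entry of a skew-symmetric matrix is zero or, up to sign, an axial
  component.\<close>

lemma lin_comb_so3_entry:
  assumes "\<And>x. x \<in> S \<Longrightarrow> M x \<in> so3"
    and ax: "\<And>i. lin_comb S G (\<lambda>x. axial (M x) $ i)"
  shows "lin_comb S G (\<lambda>x. M x $ i $ j)"
proof -
  have neg: "lin_comb S G (\<lambda>x. - axial (M x) $ i)" for i
    using lin_comb_cmult[OF ax, of "-1"] by simp
  have "i \<in> {1, 2, 3}" "j \<in> {1, 2, 3}"
    using exhaust_3[of i] exhaust_3[of j] by auto
  then show ?thesis
    by (auto intro: lin_comb_cong[OF ax] lin_comb_cong[OF neg] lin_comb_cong[OF lin_comb_zero]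
        simp: so3_axial_entries assms(1))
qed


section \<open>Uniform coefficients for second and third derivatives\<close>

lemma second_derivatives_lin_comb:
  fixes \<Omega> :: "(real^3) set"
  shows "lin_comb (distributions_on \<Omega> so3 \<times> test_functions \<Omega>)
    (\<lambda>(m, p, q) (A, f). dpartial m (sym_Curl A) f $ p $ q)
    (\<lambda>(A, f). dpartial k (dpartial l A) f $ i $ j)"
    (is "lin_comb ?S ?G _")
proof -
  \<comment> \<open>Two distributional derivatives produce two signs, which cancel; the outer
    derivative \<open>m\<close> acts first on the test function.\<close>
  define Y where "Y = (\<lambda>(A :: (3, real^3^3) distr, f) m p q. axial (A (partial p (partial m f))) $ q)"
  define S where "S = (\<lambda>(A :: (3, real^3^3) distr, f) m p q. dpartial m (sym_Curl A) f $ p $ q)"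
  have so3: "A (partial l (partial k f)) \<in> so3"
    if "(A, f) \<in> ?S" for A f k l
    using that partial_test_function unfolding distributions_on_def by blast
  have sym: "Y x m p q = Y x p m q" if "x \<in> ?S" for x m p q
    using that partial_commute[of "snd x" m p] by (auto simp: Y_def test_functions_def)
  have S: "S x m p q = kron p q * (\<Sum>r\<in>UNIV. Y x m r r) - (Y x m p q + Y x m q p) / 2"
    if "x \<in> ?S" for x m p q
  proof -
    obtain A f where x: "x = (A, f)"
      by force
    then show ?thesis
      using sym_Curl_axial[of A "partial m f" p q] so3[of A f] that
      by (simp add: S_def Y_def dpartial_def sum_negf field_simps)
  qed
  have gen: "lin_comb ?S ?G (\<lambda>x. S x m p q)" for m p q
    by (rule lin_comb_cong[OF lin_comb_generator[of _ _ "(m, p, q)"]]) (simp add: S_def split_def)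
  \<comment> \<open>\<open>second_gradient_eq\<close> turns \<open>Y\<close> into one fixed
    expression in \<open>S\<close>, from which the closure rules build the coefficients.\<close>
  have Y: "lin_comb ?S ?G (\<lambda>x. Y x k l i)" for i
    by (rule lin_comb_cong[OF _ second_gradient_eq[OF sym S]]) (intro lin_comb_intros gen)+
  have "lin_comb ?S ?G (\<lambda>(A, f). A (partial l (partial k f)) $ i $ j)"
    using lin_comb_so3_entry[of ?S "\<lambda>(A, f). A (partial l (partial k f))" ?G i j] so3 Y
    by (auto simp: Y_def split_def)
  then show ?thesis
    by (simp add: dpartial_def)
qed

lemma third_derivatives_lin_comb:
  fixes \<Omega> :: "(real^3) set"
  shows "lin_comb (distributions_on \<Omega> so3 \<times> test_functions \<Omega>)
    (\<lambda>(m, r, p, q) (A, f). dpartial m (dpartial r (dev_sym_Curl A)) f $ p $ q)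
    (\<lambda>(A, f). dpartial k (dpartial l (dpartial n A)) f $ i $ j)"
    (is "lin_comb ?S ?G _")
proof -
  \<comment> \<open>The minus sign is that of three distributional derivatives.\<close>
  define Z where "Z = (\<lambda>(A :: (3, real^3^3) distr, f) m r p q.
    - axial (A (partial p (partial r (partial m f)))) $ q)"
  define S where "S = (\<lambda>(A :: (3, real^3^3) distr, f) m r p q.
    dpartial m (dpartial r (dev_sym_Curl A)) f $ p $ q)"
  have so3: "A (partial n (partial l (partial k f))) \<in> so3"
    if "(A, f) \<in> ?S" for A f k l n
    using that partial_test_function unfolding distributions_on_def by blast
  have sym1: "Z x m r p q = Z x r m p q" if "x \<in> ?S" for x m r p q
    using that partial_commute[of "snd x" m r] by (auto simp: Z_def test_functions_def)
  have sym2: "Z x m r p q = Z x m p r q" if "x \<in> ?S" for x m r p q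
    using that partial_commute[OF smooth_partial, of "snd x" r p m]
    by (auto simp: Z_def test_functions_def)
  have S: "S x m r p q = kron p q * ((1/3) * (\<Sum>s\<in>UNIV. Z x m r s s)) - (Z x m r p q + Z x m r q p) / 2"
    if "x \<in> ?S" for x m r p q
  proof -
    obtain A f where x: "x = (A, f)"
      by force
    then show ?thesis
      using dev_sym_Curl_axial[of A "partial r (partial m f)" p q] so3[of A f] that
      by (simp add: S_def Z_def dpartial_def)
  qed
  have gen: "lin_comb ?S ?G (\<lambda>x. S x m r p q)" for m r p q
    by (rule lin_comb_cong[OF lin_comb_generator[of _ _ "(m, r, p, q)"]]) (simp add: S_def split_def)
  have Z: "lin_comb ?S ?G (\<lambda>x. Z x k l n i)" for i
    by (rule lin_comb_cong[OF _ third_gradient_eq[OF sym1 sym2 S]]) (intro lin_comb_intros gen)+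
  \<comment> \<open>The sign in \<open>Z\<close> is undone to reach the axial vector itself; the
    last step restores it for the three \<open>dpartial\<close>.\<close>
  have "lin_comb ?S ?G (\<lambda>x. - 1 * Z x k l n i)" for i
    by (intro lin_comb_intros Z)
  then have "lin_comb ?S ?G (\<lambda>(A, f). A (partial n (partial l (partial k f))) $ i $ j)"
    using lin_comb_so3_entry[of ?S "\<lambda>(A, f). A (partial n (partial l (partial k f)))" ?G i j] so3
    by (auto simp: Z_def split_def)
  from lin_comb_cmult[OF this, of "- 1"] show ?thesis
    by (simp add: dpartial_def split_def)
qed

theorem lemma2p6:
  fixes \<Omega> :: "(real^3) set"
  assumes "bounded_lipschitz_domain \<Omega>"
  shows
    "(\<exists>c :: 3 \<Rightarrow> 3 \<Rightarrow> 3 \<Rightarrow> 3 \<Rightarrow> 3 \<Rightarrow> 3 \<Rightarrow> 3 \<Rightarrow> real.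
        \<forall>A \<in> distributions_on \<Omega> so3. \<forall>k l i j. \<forall>f \<in> test_functions \<Omega>.
          dpartial k (dpartial l A) f $ i $ j =
          (\<Sum>m\<in>UNIV. \<Sum>p\<in>UNIV. \<Sum>q\<in>UNIV.
             c k l i j m p q * dpartial m (sym_Curl A) f $ p $ q)) \<and>
     (\<exists>c :: 3 \<Rightarrow> 3 \<Rightarrow> 3 \<Rightarrow> 3 \<Rightarrow> 3 \<Rightarrow> 3 \<Rightarrow> 3 \<Rightarrow> 3 \<Rightarrow> 3 \<Rightarrow> real.
        \<forall>A \<in> distributions_on \<Omega> so3. \<forall>k l n i j. \<forall>f \<in> test_functions \<Omega>.
          dpartial k (dpartial l (dpartial n A)) f $ i $ j =
          (\<Sum>m\<in>UNIV. \<Sum>r\<in>UNIV. \<Sum>p\<in>UNIV. \<Sum>q\<in>UNIV.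
             c k l n i j m r p q * dpartial m (dpartial r (dev_sym_Curl A)) f $ p $ q))"
proof
  have "\<forall>k l i j. \<exists>c. \<forall>x\<in>distributions_on \<Omega> so3 \<times> test_functions \<Omega>.
      (\<lambda>(A, f). dpartial k (dpartial l A) f $ i $ j) x =
      (\<Sum>u\<in>UNIV. c u * (\<lambda>(m, p, q) (A, f). dpartial m (sym_Curl A) f $ p $ q) u x)"
    using second_derivatives_lin_comb unfolding lin_comb_def by blast
  \<comment> \<open>Choice over the indices alone gives one family \<open>c\<close> valid for all
    \<open>A\<close> and \<open>f\<close>; it is then curried to match the nested sums.\<close>
  then obtain c where c: "\<forall>k l i j. \<forall>x\<in>distributions_on \<Omega> so3 \<times> test_functions \<Omega>.
      (\<lambda>(A, f). dpartial k (dpartial l A) f $ i $ j) x =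
      (\<Sum>u\<in>UNIV. c k l i j u * (\<lambda>(m, p, q) (A, f). dpartial m (sym_Curl A) f $ p $ q) u x)"
    unfolding choice_iff by blast
  show "\<exists>c :: 3 \<Rightarrow> 3 \<Rightarrow> 3 \<Rightarrow> 3 \<Rightarrow> 3 \<Rightarrow> 3 \<Rightarrow> 3 \<Rightarrow> real.
        \<forall>A \<in> distributions_on \<Omega> so3. \<forall>k l i j. \<forall>f \<in> test_functions \<Omega>.
          dpartial k (dpartial l A) f $ i $ j =
          (\<Sum>m\<in>UNIV. \<Sum>p\<in>UNIV. \<Sum>q\<in>UNIV.
             c k l i j m p q * dpartial m (sym_Curl A) f $ p $ q)"
    using c
    by (intro exI[of _ "\<lambda>k l i j m p q. c k l i j (m, p, q)"])
      (simp add: sum.cartesian_product split_def)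
next
  have "\<forall>k l n i j. \<exists>c. \<forall>x\<in>distributions_on \<Omega> so3 \<times> test_functions \<Omega>.
      (\<lambda>(A, f). dpartial k (dpartial l (dpartial n A)) f $ i $ j) x =
      (\<Sum>u\<in>UNIV. c u *
        (\<lambda>(m, r, p, q) (A, f). dpartial m (dpartial r (dev_sym_Curl A)) f $ p $ q) u x)"
    using third_derivatives_lin_comb unfolding lin_comb_def by blast
  then obtain c where c: "\<forall>k l n i j. \<forall>x\<in>distributions_on \<Omega> so3 \<times> test_functions \<Omega>.
      (\<lambda>(A, f). dpartial k (dpartial l (dpartial n A)) f $ i $ j) x =
      (\<Sum>u\<in>UNIV. c k l n i j u *
        (\<lambda>(m, r, p, q) (A, f). dpartial m (dpartial r (dev_sym_Curl A)) f $ p $ q) u x)"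
    unfolding choice_iff by blast
  show "\<exists>c :: 3 \<Rightarrow> 3 \<Rightarrow> 3 \<Rightarrow> 3 \<Rightarrow> 3 \<Rightarrow> 3 \<Rightarrow> 3 \<Rightarrow> 3 \<Rightarrow> 3 \<Rightarrow> real.
        \<forall>A \<in> distributions_on \<Omega> so3. \<forall>k l n i j. \<forall>f \<in> test_functions \<Omega>.
          dpartial k (dpartial l (dpartial n A)) f $ i $ j =
          (\<Sum>m\<in>UNIV. \<Sum>r\<in>UNIV. \<Sum>p\<in>UNIV. \<Sum>q\<in>UNIV.
             c k l n i j m r p q * dpartial m (dpartial r (dev_sym_Curl A)) f $ p $ q)"
    using c
    by (intro exI[of _ "\<lambda>k l n i j m r p q. c k l n i j (m, r, p, q)"])
      (simp add: sum.cartesian_product split_def)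
qed

end
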